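(* Let $\mathcal{H}$ be a separable infinite-dimensional real Hilbert space. Then there is a family, of the cardinality of the continuum, of pairwise non-similar Lomonosov algebras of complex type on $\mathcal{H}$.
   Context: $\mathcal{B}(\mathcal{X})$ is the algebra of all bounded linear operators on a real Banach space $\mathcal{X}$; SOT is the strong operator topology. A subalgebra of $\mathcal{B}(\mathcal{X})$ is transitive if it has no non-trivial closed invariant subspaces. A Lomonosov algebra is an SOT-closed transitive subalgebra of $\mathcal{B}(\mathcal{X})$ containing a non-zero compact operator; every Lomonosov algebra contains a non-zero finite rank operator. For a Lomonosov algebra $\mathcal{A}$, $\mathcal{A}^F$ is the set of all finite rank operators in $\mathcal{A}$, $\mathcal{X}^F=\mathrm{lin}\{Tx: T\in\mathcal{A}^F, x\in\mathcal{X}\}$, and $\mathbb{D}$ is the algebra of all linear operators $\mathcal{X}^F\to\mathcal{X}^F$ (not assumed bounded) commuting with the restrictions to $\mathcal{X}^F$ of all operators in $\mathcal{A}^F$. When $\mathcal{X}$ is infinite-dimensional, $\mathbb{D}$ is always isomorphic to $\mathbb{R}$, $\mathbb{C}$ or the quaternions $\mathbb{H}$, and $\mathcal{A}$ is said to be of real, complex or quaternion type, respectively. Two algebras $\mathcal{A}_1,\mathcal{A}_2\subset\mathcal{B}(\mathcal{H})$ are similar if $T\mathcal{A}_1T^{-1}=\mathcal{A}_2$ for some bounded invertible operator $T$ on $\mathcal{H}$. *)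

theory Defs
  imports "HOL-Analysis.Analysis"
begin

text \<open>Subalgebras are not required to contain the identity.\<close>

definition operator_subalgebra :: "('a::banach \<Rightarrow>\<^sub>L 'a) set \<Rightarrow> bool" where
  "operator_subalgebra A \<longleftrightarrow> subspace A \<and> (\<forall>S\<in>A. \<forall>T\<in>A. S o\<^sub>L T \<in> A)"

definition transitive_algebra :: "('a::banach \<Rightarrow>\<^sub>L 'a) set \<Rightarrow> bool" where
  "transitive_algebra A \<longleftrightarrow>
     (\<forall>M. subspace M \<and> closed M \<and> (\<forall>T\<in>A. blinfun_apply T ` M \<subseteq> M) \<longrightarrow> M = {0} \<or> M = UNIV)"

definition compact_operator :: "('a::banach \<Rightarrow>\<^sub>L 'a) \<Rightarrow> bool" where
  "compact_operator T \<longleftrightarrow> (\<forall>B. bounded B \<longrightarrow> compact (closure (blinfun_apply T ` B)))"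

definition finite_dimensional_space :: "'a::real_vector set \<Rightarrow> bool" where
  "finite_dimensional_space V \<longleftrightarrow> (\<exists>B. finite B \<and> span B = V)"

definition finite_rank_operator :: "('a::banach \<Rightarrow>\<^sub>L 'a) \<Rightarrow> bool" where
  "finite_rank_operator T \<longleftrightarrow> finite_dimensional_space (range (blinfun_apply T))"

definition lomonosov_algebra :: "('a::banach \<Rightarrow>\<^sub>L 'a) set \<Rightarrow> bool" where
  "lomonosov_algebra A \<longleftrightarrow>
     operator_subalgebra A \<and> closedin strong_operator_topology A \<and> transitive_algebra A \<and>
     (\<exists>T\<in>A. compact_operator T \<and> T \<noteq> 0)"

definition finite_rank_part :: "('a::banach \<Rightarrow>\<^sub>L 'a) set \<Rightarrow> ('a \<Rightarrow>\<^sub>L 'a) set" where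
  "finite_rank_part A = {T \<in> A. finite_rank_operator T}"

definition finite_rank_space :: "('a::banach \<Rightarrow>\<^sub>L 'a) set \<Rightarrow> 'a set" where
  "finite_rank_space A = span {blinfun_apply T x | T x. T \<in> finite_rank_part A}"

text \<open>
  A linear map from \<open>finite_rank_space A\<close> to itself is represented by an extensional function
  (\<open>undefined\<close> off the domain), so that equality of functions is equality of operators. No
  continuity is demanded.
\<close>

definition commutant_algebra :: "('a::banach \<Rightarrow>\<^sub>L 'a) set \<Rightarrow> ('a \<Rightarrow> 'a) set" where
  "commutant_algebra A = {S \<in> finite_rank_space A \<rightarrow>\<^sub>E finite_rank_space A.
     (\<forall>x\<in>finite_rank_space A. \<forall>y\<in>finite_rank_space A. S (x + y) = S x + S y) \<and>
     (\<forall>r. \<forall>x\<in>finite_rank_space A. S (r *\<^sub>R x) = r *\<^sub>R S x) \<and>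
     (\<forall>T\<in>finite_rank_part A. \<forall>x\<in>finite_rank_space A.
        S (blinfun_apply T x) = blinfun_apply T (S x))}"

definition commutant_isomorphism ::
  "('a::banach \<Rightarrow>\<^sub>L 'a) set \<Rightarrow> ('d::real_algebra_1 \<Rightarrow> 'a \<Rightarrow> 'a) \<Rightarrow> bool" where
  "commutant_isomorphism A \<phi> \<longleftrightarrow>
     bij_betw \<phi> UNIV (commutant_algebra A) \<and>
     (\<forall>z w. \<forall>x\<in>finite_rank_space A. \<phi> (z + w) x = \<phi> z x + \<phi> w x) \<and>
     (\<forall>r z. \<forall>x\<in>finite_rank_space A. \<phi> (r *\<^sub>R z) x = r *\<^sub>R \<phi> z x) \<and>
     (\<forall>z w. \<forall>x\<in>finite_rank_space A. \<phi> (z * w) x = \<phi> z (\<phi> w x)) \<and>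
     (\<forall>x\<in>finite_rank_space A. \<phi> 1 x = x)"

definition complex_type :: "('a::banach \<Rightarrow>\<^sub>L 'a) set \<Rightarrow> bool" where
  "complex_type A \<longleftrightarrow> (\<exists>\<phi> :: complex \<Rightarrow> 'a \<Rightarrow> 'a. commutant_isomorphism A \<phi>)"

definition similar_algebras :: "('a::banach \<Rightarrow>\<^sub>L 'a) set \<Rightarrow> ('a \<Rightarrow>\<^sub>L 'a) set \<Rightarrow> bool" where
  "similar_algebras A B \<longleftrightarrow>
     (\<exists>T T'. T o\<^sub>L T' = id_blinfun \<and> T' o\<^sub>L T = id_blinfun \<and> (\<lambda>S. T o\<^sub>L S o\<^sub>L T') ` A = B)"

end

theory Submission
  imports Defs
begin

text \<open>
  Each algebra of the family consists of all bounded operators that commute with one fixed closed,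
  densely defined real-linear operator \<open>J\<close> with \<open>J\<^sup>2 = -1\<close> on its domain. Up to similarity there is
  only one bounded complex structure on a separable infinite-dimensional real Hilbert space, so a
  large family needs unbounded ones.

  Write \<open>J\<close> as its graph \<open>G\<close>. The algebra is \<open>{T. (T \<times> T) G \<subseteq> G}\<close>, and closedness of \<open>G\<close> makes it
  closed in the strong operator topology. If \<open>p\<close>, \<open>q\<close> satisfy \<open>\<langle>p, J x\<rangle> = \<langle>q, x\<rangle>\<close> on the domain, so that
  \<open>x \<mapsto> \<langle>p, x\<rangle> - i \<langle>q, x\<rangle>\<close> is a \<open>J\<close>-complex-linear functional, then
  \<open>x \<mapsto> \<langle>p, x\<rangle> v - \<langle>q, x\<rangle> J v\<close> lies in the algebra for every \<open>v\<close> in the domain. It has complex rank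
  one. If such functionals separate points, these operators carry any nonzero vector to any vector
  of the domain, whence the algebra is transitive (\<open>transitive_graph_algebra\<close>), the space spanned by the
  ranges of its finite-rank members is exactly the domain of \<open>J\<close>
  (\<open>finite_rank_space_graph_algebra\<close>), and a linear map of the domain that commutes with all of them
  is \<open>a + b J\<close> (\<open>commuting_map_is_combination\<close>). So the algebra is Lomonosov of complex type.

  A similarity \<open>T\<close> between the algebras of \<open>J\<^sub>1\<close> and \<open>J\<^sub>2\<close> carries the first domain to the second,
  and \<open>T J\<^sub>1 T\<^sup>-\<^sup>1\<close> commutes with the finite-rank operators of the second algebra. Hence it is
  \<open>a + b J\<^sub>2\<close>, and squaring it gives \<open>T J\<^sub>1 T\<^sup>-\<^sup>1 = \<plusminus> J\<^sub>2\<close> (\<open>similarity_intertwines\<close>).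

  Concretely, fix an orthonormal basis \<open>e\<^sub>0, e\<^sub>1, \<dots>\<close> and let \<open>J e\<^bsub>2n\<^esub> = l\<^sub>n e\<^bsub>2n+1\<^esub>\<close> with weights
  \<open>l\<^sub>n > 0\<close>. If \<open>T\<close> intertwines the structures with weights \<open>l\<close> and \<open>m\<close>, comparing coordinates bounds the
  entry of \<open>T\<close> at \<open>(e\<^bsub>2k\<^esub>, e\<^bsub>2n\<^esub>)\<close> by \<open>\<parallel>T\<parallel> l\<^sub>n / m\<^sub>k\<close>, and the opposite entry of the inverse by
  \<open>\<parallel>T\<^sup>-\<^sup>1\<parallel> m\<^sub>k / l\<^sub>n\<close>. Entries between an even and an odd vector contribute products of order
  \<open>1 / (l\<^sub>n m\<^sub>k)\<close>. If every \<open>m\<^sub>k\<close> is far from every \<open>l\<^sub>n\<close> and the weights grow, all these products are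
  tiny, and so the diagonal entry of \<open>T T\<^sup>-\<^sup>1\<close> at \<open>e\<^bsub>2k\<^esub>\<close> tends to \<open>0\<close> although it equals \<open>1\<close>
  (\<open>separated_weights_not_similar\<close>). The weights \<open>exp ((n + s)\<^sup>2)\<close> with \<open>0 < s < 1\<close> are
  separated in this sense for any two different values of \<open>s\<close>, which gives continuum many classes.
\<close>

section \<open>Finite-dimensional subspaces and orthonormal sequences\<close>

text \<open>
  The span is the fixed-point set of the orthogonal projection onto it, which is a finite sum of
  continuous maps.
\<close>

lemma closed_span_finite:
  fixes B :: "'a::real_inner set"
  assumes "finite B"
  shows "closed (span B)"
proof -
  obtain C where C: "finite C" "span C = span B" "pairwise orthogonal C"
    using basis_orthogonal[OF assms] by blast
  define P where "P x = (\<Sum>c\<in>C. (x \<bullet> c / (c \<bullet> c)) *\<^sub>R c)" for x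
  have P_span: "P x \<in> span C" for x
    unfolding P_def by (intro span_sum span_mul span_base)
  have P_linear: "linear P"
    unfolding P_def
    by (intro linearI) (simp_all add: inner_left_distrib add_divide_distrib scaleR_add_left
        sum.distrib scaleR_sum_right)
  have P_base: "P c = c" if "c \<in> C" for c
  proof -
    have "P c = (\<Sum>d\<in>C. if d = c then c else 0)"
      unfolding P_def using C(3) that
      by (intro sum.cong) (auto simp: pairwise_def orthogonal_def inner_commute)
    then show ?thesis
      using that C(1) by simp
  qed
  have "P x = id x" if "x \<in> span C" for x
    using linear_eq_on[OF P_linear linear_id that] P_base by simp
  then have "span C = {x. P x = x}"
    using P_span by (auto, metis)
  moreover have "closed {x. P x = x}"
    unfolding P_def divide_inverse by (intro closed_Collect_eq continuous_intros)
  ultimately show ?thesis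
    using C(2) by simp
qed

lemma finite_dimensional_space_subspace:
  assumes "subspace V" "V \<subseteq> span B" "finite B"
  shows "finite_dimensional_space V"
proof -
  obtain C where C: "C \<subseteq> V" "independent C" "V \<subseteq> span C"
    by (rule maximal_independent_subset)
  then have "span C = V"
    using assms(1) by (simp add: span_minimal subset_antisym)
  moreover have "finite C"
    using independent_span_bound[OF assms(3) C(2)] C(1) assms(2) by blast
  ultimately show ?thesis
    unfolding finite_dimensional_space_def by blast
qed

lemma finite_dimensional_space_image:
  assumes "linear f" "finite_dimensional_space V"
  shows "finite_dimensional_space (f ` V)"
  using assms linear_span_image[OF assms(1)] unfolding finite_dimensional_space_def
  by (metis finite_imageI)

fun gram_schmidt :: "(nat \<Rightarrow> 'a::real_inner) \<Rightarrow> nat \<Rightarrow> 'a" where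
  "gram_schmidt b n =
     sgn (b n - (\<Sum>i<n. (b n \<bullet> gram_schmidt b i) *\<^sub>R gram_schmidt b i))"

declare gram_schmidt.simps [simp del]

definition orthonormal_sequence :: "(nat \<Rightarrow> 'a::real_inner) \<Rightarrow> bool" where
  "orthonormal_sequence e \<longleftrightarrow> (\<forall>m n. e m \<bullet> e n = (if m = n then 1 else 0))"

lemma gram_schmidt_in_span: "gram_schmidt b n \<in> span (b ` {..n})"
proof (induction n rule: less_induct)
  case (less n)
  have "gram_schmidt b i \<in> span (b ` {..n})" if "i < n" for i
  proof -
      have "b ` {..i} \<subseteq> b ` {..n}"
        using that by auto
      then show ?thesis
        using less[OF that] span_mono by blast
    qed
  then show ?case
    by (subst gram_schmidt.simps, unfold sgn_div_norm, intro span_mul span_diff span_sum)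
      (simp_all add: span_base)
qed

lemma orthonormal_gram_schmidt:
  fixes b :: "nat \<Rightarrow> 'a::real_inner"
  assumes "inj b" "independent (range b)"
  shows "orthonormal_sequence (gram_schmidt b)"
proof -
  define e where "e = gram_schmidt b"
  define r where "r n = b n - (\<Sum>i<n. (b n \<bullet> e i) *\<^sub>R e i)" for n
  have e_r: "e n = sgn (r n)" for n
    unfolding e_def r_def by (subst gram_schmidt.simps) simp
  have r_nonzero: "r n \<noteq> 0" for n
  proof
    assume "r n = 0"
    then have "b n = (\<Sum>i<n. (b n \<bullet> e i) *\<^sub>R e i)"
      by (simp add: r_def)
    moreover have "e i \<in> span (b ` {..<n})" if "i < n" for i
    proof -
      have "b ` {..i} \<subseteq> b ` {..<n}"
        using that by auto
      then show ?thesis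
        unfolding e_def using gram_schmidt_in_span span_mono by blast
    qed
    ultimately have "b n \<in> span (b ` {..<n})"
      by (metis (no_types, lifting) lessThan_iff span_mul span_sum)
    moreover have "b ` {..<n} \<subseteq> range b - {b n}"
      using assms(1) by (auto simp: inj_def)
    ultimately show False
      using assms(2) span_mono unfolding dependent_def by blast
  qed
  then have unit: "e n \<bullet> e n = 1" for n
    by (simp add: e_r sgn_div_norm dot_square_norm power2_eq_square)
  have orth: "\<forall>m<n. e n \<bullet> e m = 0" for n
  proof (induction n rule: less_induct)
    case (less n)
    show ?case
    proof (intro allI impI)
      fix m assume m: "m < n"
      have "(\<Sum>i<n. (b n \<bullet> e i) * (e i \<bullet> e m)) = (\<Sum>i<n. if i = m then b n \<bullet> e m else 0)"
      proof (intro sum.cong)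
        fix i assume "i \<in> {..<n}"
        then have "e i \<bullet> e m = 0" if "i \<noteq> m"
          using less[of i] less[of m] m that inner_commute[of "e i" "e m"]
          by (cases i m rule: linorder_cases) simp_all
        then show "(b n \<bullet> e i) * (e i \<bullet> e m) = (if i = m then b n \<bullet> e m else 0)"
          by (auto simp: unit)
      qed simp
      then have "r n \<bullet> e m = 0"
        using m by (simp add: r_def inner_diff_left inner_sum_left)
      then show "e n \<bullet> e m = 0"
        by (subst e_r) (simp add: sgn_div_norm)
    qed
  qed
  then have "e m \<bullet> e n = 0" if "m \<noteq> n" for m n
    using that by (metis inner_commute linorder_neqE_nat)
  then show ?thesis
    unfolding orthonormal_sequence_def e_def[symmetric] by (simp add: unit)
qed

lemma range_subset_span_gram_schmidt:
  fixes b :: "nat \<Rightarrow> 'a::real_inner"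
  shows "range b \<subseteq> span (range (gram_schmidt b))"
proof
  fix x assume "x \<in> range b"
  then obtain n where x: "x = b n"
    by blast
  define s where "s = (\<Sum>i<n. (b n \<bullet> gram_schmidt b i) *\<^sub>R gram_schmidt b i)"
  have expand: "norm (b n - s) *\<^sub>R gram_schmidt b n + s = b n"
    by (subst gram_schmidt.simps) (cases "b n = s"; simp add: s_def[symmetric] sgn_div_norm)
  have "norm (b n - s) *\<^sub>R gram_schmidt b n + s \<in> span (range (gram_schmidt b))"
    unfolding s_def by (intro span_add span_sum span_mul span_base) simp_all
  then show "x \<in> span (range (gram_schmidt b))"
    unfolding x expand .
qed

text \<open>
  A maximal independent subset of a countable dense set is infinite, because a finite one would have
  a closed and dense span, that is, span the whole space. Gram-Schmidt turns an enumeration of it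
  into the required sequence.
\<close>

lemma orthonormal_basis_exists:
  assumes "separable_space (euclidean :: 'h::real_inner topology)"
    and "\<not> finite_dimensional_space (UNIV :: 'h set)"
  shows "\<exists>e :: nat \<Rightarrow> 'h. orthonormal_sequence e \<and> closure (span (range e)) = UNIV"
proof -
  obtain C :: "'h set" where C: "countable C" "closure C = UNIV"
    using assms(1) by (auto simp: separable_space_def)
  obtain B where B: "B \<subseteq> C" "independent B" "C \<subseteq> span B"
    by (rule maximal_independent_subset)
  then have dense: "closure (span B) = UNIV"
    using C(2) closure_mono by blast
  have "infinite B"
    using assms(2) closed_span_finite[of B] dense
    by (auto simp: finite_dimensional_space_def closure_closed)
  moreover have "countable B"
    using B(1) C(1) countable_subset by blast
  ultimately have "bij_betw (from_nat_into B) UNIV B"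
    by (rule bij_betw_from_nat_into[rotated])
  then obtain b :: "nat \<Rightarrow> 'h" where b: "inj b" "range b = B"
    by (auto simp: bij_betw_def)
  have "span B \<subseteq> span (range (gram_schmidt b))"
    using range_subset_span_gram_schmidt[of b] b(2) by (simp add: span_minimal)
  then have "closure (span (range (gram_schmidt b))) = UNIV"
    using dense closure_mono by blast
  with orthonormal_gram_schmidt[of b] b B(2) show ?thesis
    by blast
qed

text \<open>
  The partial sums are best approximations from the spans of initial segments, so they are eventually
  as good as any given finite combination of the \<open>e\<^sub>n\<close>.
\<close>

lemma orthonormal_expansion:
  fixes e :: "nat \<Rightarrow> 'a::real_inner"
  assumes e: "orthonormal_sequence e" and dense: "closure (span (range e)) = UNIV"
  shows "(\<lambda>n. (x \<bullet> e n) *\<^sub>R e n) sums x"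
  unfolding sums_def
proof (rule LIMSEQ_I)
  fix \<epsilon> :: real assume "0 < \<epsilon>"
  moreover have "x \<in> closure (span (range e))"
    by (simp add: dense)
  ultimately obtain y where y: "y \<in> span (range e)" "norm (x - y) < \<epsilon>"
    by (auto simp: closure_approachable dist_norm norm_minus_commute)
  from y(1) obtain S f where S: "finite S" "S \<subseteq> range e" "y = (\<Sum>a\<in>S. f a *\<^sub>R a)"
    unfolding span_explicit mem_Collect_eq by (elim exE conjE) (rule that)
  obtain I where I: "finite I" "S = e ` I"
    using finite_subset_image[OF S(1,2)] by (auto intro: that)
  obtain N where N: "I \<subseteq> {..<N}"
    using I(1) finite_nat_iff_bounded by blast
  have "norm ((\<Sum>n<m. (x \<bullet> e n) *\<^sub>R e n) - x) < \<epsilon>" if "N \<le> m" for m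
  proof -
    define s where "s = (\<Sum>n<m. (x \<bullet> e n) *\<^sub>R e n)"
    have s_e: "s \<bullet> e n = x \<bullet> e n" if "n < m" for n
    proof -
      have "s \<bullet> e n = (\<Sum>i<m. if i = n then x \<bullet> e n else 0)"
        unfolding s_def inner_sum_left using e
        by (intro sum.cong) (auto simp: orthonormal_sequence_def)
      then show ?thesis
        using that by simp
    qed
    have orth: "(x - s) \<bullet> z = 0" if "z \<in> span (e ` {..<m})" for z
      using that
      by (induction rule: span_induct_alt)
        (auto simp: inner_add_right inner_diff_left s_e)
    have "y \<in> span (e ` {..<m})"
      unfolding S(3) using I N that by (intro span_sum span_mul span_base) auto
    moreover have "s \<in> span (e ` {..<m})"
      unfolding s_def by (intro span_sum span_mul span_base) auto
    ultimately have "(x - s) \<bullet> (s - y) = 0"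
      by (intro orth span_diff)
    then have "(norm ((x - s) + (s - y)))\<^sup>2 = (norm (x - s))\<^sup>2 + (norm (s - y))\<^sup>2"
      by (intro norm_add_Pythagorean) (simp add: orthogonal_def)
    then have "(norm (x - s))\<^sup>2 \<le> (norm (x - y))\<^sup>2"
      by simp
    then have "norm (x - s) \<le> norm (x - y)"
      by (rule power2_le_imp_le) simp
    with y(2) show ?thesis
      unfolding s_def[symmetric] by (simp add: norm_minus_commute)
  qed
  then show "\<exists>N. \<forall>m\<ge>N. norm ((\<Sum>n<m. (x \<bullet> e n) *\<^sub>R e n) - x) < \<epsilon>"
    by blast
qed

section \<open>The algebra of a closed, densely defined complex structure\<close>

definition graph_algebra :: "('a::banach \<times> 'a) set \<Rightarrow> ('a \<Rightarrow>\<^sub>L 'a) set" where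
  "graph_algebra G = {T. \<forall>(x, y)\<in>G. (blinfun_apply T x, T y) \<in> G}"

lemma graph_algebraD: "T \<in> graph_algebra G \<Longrightarrow> (x, y) \<in> G \<Longrightarrow> (T x, T y) \<in> G"
  by (auto simp: graph_algebra_def)

lemma operator_subalgebra_graph_algebra:
  assumes "subspace G"
  shows "operator_subalgebra (graph_algebra G)"
  unfolding operator_subalgebra_def graph_algebra_def
proof (intro conjI subspaceI ballI)
  show "0 \<in> {T. \<forall>(x, y)\<in>G. (blinfun_apply T x, T y) \<in> G}"
    using subspace_0[OF assms] by (auto simp: zero_prod_def)
next
  fix S T :: "'a \<Rightarrow>\<^sub>L 'a"
  assume "S \<in> {T. \<forall>(x, y)\<in>G. (blinfun_apply T x, T y) \<in> G}" "T \<in> {T. \<forall>(x, y)\<in>G. (blinfun_apply T x, T y) \<in> G}"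
  then show "S + T \<in> {T. \<forall>(x, y)\<in>G. (blinfun_apply T x, T y) \<in> G}"
    using subspace_add[OF assms] by (fastforce simp: blinfun.add_left)
next
  fix c and T :: "'a \<Rightarrow>\<^sub>L 'a"
  assume "T \<in> {T. \<forall>(x, y)\<in>G. (blinfun_apply T x, T y) \<in> G}"
  then show "c *\<^sub>R T \<in> {T. \<forall>(x, y)\<in>G. (blinfun_apply T x, T y) \<in> G}"
    using subspace_scale[OF assms] by (fastforce simp: blinfun.scaleR_left)
next
  fix S T :: "'a \<Rightarrow>\<^sub>L 'a"
  assume "S \<in> {T. \<forall>(x, y)\<in>G. (blinfun_apply T x, T y) \<in> G}" "T \<in> {T. \<forall>(x, y)\<in>G. (blinfun_apply T x, T y) \<in> G}"
  then show "S o\<^sub>L T \<in> {T. \<forall>(x, y)\<in>G. (blinfun_apply T x, T y) \<in> G}"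
    by fastforce
qed

lemma closedin_graph_algebra:
  assumes "closed G"
  shows "closedin strong_operator_topology (graph_algebra G)"
proof (cases "G = {}")
  case True
  then have "graph_algebra G = topspace strong_operator_topology"
    by (simp add: graph_algebra_def strong_operator_topology_topspace)
  then show ?thesis
    by (metis closedin_topspace)
next
  case False
  have "closedin strong_operator_topology {T. (blinfun_apply T x, T y) \<in> G}" for x y :: 'a
  proof -
    have "continuous_map strong_operator_topology (prod_topology euclidean euclidean)
        (\<lambda>T :: 'a \<Rightarrow>\<^sub>L 'a. (T x, T y))"
      by (intro continuous_map_pairedI strong_operator_topology_continuous_evaluation)
    then have "closedin strong_operator_topology
        {T \<in> topspace strong_operator_topology. (blinfun_apply T x, T y) \<in> G}"
      using assms by (intro closedin_continuous_map_preimage) auto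
    then show ?thesis
      by (simp add: strong_operator_topology_topspace)
  qed
  then have "closedin strong_operator_topology (\<Inter>z\<in>G. {T. (blinfun_apply T (fst z), T (snd z)) \<in> G})"
    using False by (intro closedin_INT)
  moreover have "(\<Inter>z\<in>G. {T. (blinfun_apply T (fst z), T (snd z)) \<in> G}) = graph_algebra G"
    by (auto simp: graph_algebra_def split: prod.splits) (metis fst_conv snd_conv)
  ultimately show ?thesis
    by simp
qed

text \<open>
  The vectors \<open>p\<close> and \<open>q\<close> represent the real part and minus the imaginary part of a bounded functional
  that is complex-linear on the domain: in terms of the operator \<open>J\<close> with graph \<open>G\<close>, \<open>p\<close> lies in the
  domain of the adjoint of \<open>J\<close> and \<open>q\<close> is its image.
\<close>

definition dual_pair :: "('a::real_inner \<times> 'a) set \<Rightarrow> 'a \<Rightarrow> 'a \<Rightarrow> bool" where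
  "dual_pair G p q \<longleftrightarrow> (\<forall>(x, y)\<in>G. p \<bullet> y = q \<bullet> x)"

text \<open>
  With \<open>w = J v\<close> this is \<open>x \<mapsto> f(x) v\<close>, where \<open>f = p - i q\<close> and \<open>i\<close> acts as \<open>J\<close>.
\<close>

definition complex_rank_one :: "'a::real_inner \<Rightarrow> 'a \<Rightarrow> 'a \<Rightarrow> 'a \<Rightarrow> 'a \<Rightarrow>\<^sub>L 'a" where
  "complex_rank_one p q v w = Blinfun (\<lambda>x. (p \<bullet> x) *\<^sub>R v - (q \<bullet> x) *\<^sub>R w)"

lemma complex_rank_one_apply [simp]:
  "complex_rank_one p q v w x = (p \<bullet> x) *\<^sub>R v - (q \<bullet> x) *\<^sub>R w"
proof -
  have "bounded_linear (\<lambda>x. (p \<bullet> x) *\<^sub>R v - (q \<bullet> x) *\<^sub>R w)"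
    by (intro bounded_linear_sub bounded_linear_scaleR_const bounded_linear_inner_right)
  then show ?thesis
    unfolding complex_rank_one_def by (simp add: bounded_linear_Blinfun_apply)
qed

lemma finite_rank_complex_rank_one:
  fixes v :: "'a::{real_inner, banach}"
  shows "finite_rank_operator (complex_rank_one p q v w)"
  unfolding finite_rank_operator_def
proof (rule finite_dimensional_space_subspace)
  show "subspace (range (complex_rank_one p q v w))"
    by (intro linear_subspace_image subspace_UNIV bounded_linear.linear blinfun.bounded_linear_right)
  show "range (complex_rank_one p q v w) \<subseteq> span {v, w}"
    unfolding image_subset_iff complex_rank_one_apply
    by (intro ballI span_diff span_mul span_base) simp_all
qed simp

lemma compact_complex_rank_one:
  fixes v :: "'a::{real_inner, banach}"
  shows "compact_operator (complex_rank_one p q v w)"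
  unfolding compact_operator_def
proof (intro allI impI)
  fix B :: "'a set" assume "bounded B"
  then obtain M where M: "\<And>x. x \<in> B \<Longrightarrow> norm x \<le> M"
    by (auto simp: bounded_iff)
  define K where "K = (\<lambda>(a, b). a *\<^sub>R v - b *\<^sub>R w) `
      (cball 0 (norm p * M) \<times> cball (0::real) (norm q * M))"
  \<comment> \<open>The operator factors through \<open>\<real>\<^sup>2\<close>, and \<open>K\<close> is the image of a rectangle that contains the
    coefficients coming from \<open>B\<close>.\<close>
  have "compact K"
    unfolding K_def case_prod_unfold
    by (intro compact_continuous_image continuous_intros compact_Times compact_cball)
  have bound: "\<bar>r \<bullet> x\<bar> \<le> norm r * M" if "x \<in> B" for r x
    using Cauchy_Schwarz_ineq2[of r x] M[OF that] mult_left_mono[of "norm x" M "norm r"] by auto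
  have "complex_rank_one p q v w x \<in> K" if "x \<in> B" for x
    unfolding K_def complex_rank_one_apply using bound[OF that]
    by (intro image_eqI[where x = "(p \<bullet> x, q \<bullet> x)"]) auto
  then have "closure (complex_rank_one p q v w ` B) \<subseteq> K"
    using \<open>compact K\<close> by (intro closure_minimal compact_imp_closed) auto
  then show "compact (closure (complex_rank_one p q v w ` B))"
    using \<open>compact K\<close> compact_Int_closed[OF _ closed_closure] by (metis inf.absorb_iff2)
qed

text \<open>
  A closed, densely defined operator \<open>J\<close> with \<open>J\<^sup>2 = -1\<close>, given by its graph. That dual pairs separate
  points says that the adjoint of \<open>J\<close> is densely defined.
\<close>

locale closed_complex_structure =
  fixes G :: "('a::{real_inner, banach} \<times> 'a) set"
  assumes subspace_graph: "subspace G"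
    and closed_graph: "closed G"
    and single_valued: "(0, y) \<in> G \<Longrightarrow> y = 0"
    and rotate: "(x, y) \<in> G \<Longrightarrow> (y, - x) \<in> G"
    and dense_domain: "closure (Domain G) = UNIV"
    and dual_pairs_separate: "x \<noteq> 0 \<Longrightarrow> \<exists>p q. dual_pair G p q \<and> p \<bullet> x \<noteq> 0"
    and nontrivial: "\<exists>x y. (x, y) \<in> G \<and> x \<noteq> 0"
begin

definition J :: "'a \<Rightarrow> 'a" where
  "J x = (SOME y. (x, y) \<in> G)"

lemma graph_combination:
  assumes "(x, y) \<in> G" "(x', y') \<in> G"
  shows "(a *\<^sub>R x + b *\<^sub>R x', a *\<^sub>R y + b *\<^sub>R y') \<in> G"
  using subspace_add[OF subspace_graph subspace_scale[OF subspace_graph assms(1), of a]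
      subspace_scale[OF subspace_graph assms(2), of b]] by simp

lemma graph_unique:
  assumes "(x, y) \<in> G" "(x, y') \<in> G"
  shows "y = y'"
  using graph_combination[OF assms, of 1 "- 1"] single_valued[of "y - y'"] by simp

lemma graph_J: "x \<in> Domain G \<Longrightarrow> (x, J x) \<in> G"
  unfolding J_def by (metis DomainE someI_ex)

lemma J_eq: "(x, y) \<in> G \<Longrightarrow> J x = y"
  using graph_J graph_unique by blast

lemma J_in_domain: "x \<in> Domain G \<Longrightarrow> J x \<in> Domain G"
  using rotate[OF graph_J] by blast

lemma J_J: "x \<in> Domain G \<Longrightarrow> J (J x) = - x"
  using rotate[OF graph_J] J_eq by blast

lemma subspace_domain: "subspace (Domain G)"
  using linear_subspace_image[OF bounded_linear.linear[OF bounded_linear_fst] subspace_graph]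
  by (simp add: Domain_fst)

lemma J_combination:
  assumes "x \<in> Domain G" "y \<in> Domain G"
  shows "J (a *\<^sub>R x + b *\<^sub>R y) = a *\<^sub>R J x + b *\<^sub>R J y"
  by (intro J_eq graph_combination graph_J assms)

lemma combination_in_domain:
  assumes "x \<in> Domain G"
  shows "a *\<^sub>R x + b *\<^sub>R J x \<in> Domain G"
  by (intro subspace_add subspace_scale subspace_domain assms J_in_domain)

text \<open>
  A complex number \<open>a + i b\<close> that kills a nonzero vector is zero: multiply by the conjugate.
\<close>

lemma combination_eq_0:
  assumes "x \<in> Domain G" "x \<noteq> 0" "a *\<^sub>R x + b *\<^sub>R J x = 0"
  shows "a = 0 \<and> b = 0"
proof -
  have "J (a *\<^sub>R x + b *\<^sub>R J x) = a *\<^sub>R J x - b *\<^sub>R x"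
    using assms(1) by (subst J_combination) (simp_all add: J_in_domain J_J)
  moreover have "J 0 = 0"
    using J_combination[OF assms(1) assms(1), of 0 0] by simp
  ultimately have *: "a *\<^sub>R J x - b *\<^sub>R x = 0"
    using assms(3) by simp
  have "(a * a + b * b) *\<^sub>R x = a *\<^sub>R (a *\<^sub>R x + b *\<^sub>R J x) - b *\<^sub>R (a *\<^sub>R J x - b *\<^sub>R x)"
    by (simp add: algebra_simps)
  then have "a * a + b * b = 0"
    using * assms(2,3) by simp
  then show ?thesis
    by (simp add: sum_squares_eq_zero_iff)
qed

lemma combination_eq_iff:
  assumes "x \<in> Domain G" "x \<noteq> 0"
  shows "a *\<^sub>R x + b *\<^sub>R J x = c *\<^sub>R x + d *\<^sub>R J x \<longleftrightarrow> a = c \<and> b = d"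
  using combination_eq_0[OF assms, of "a - c" "b - d"] by (auto simp: algebra_simps)

lemma complex_rank_one_in_algebra:
  assumes "dual_pair G p q" "(v, w) \<in> G"
  shows "complex_rank_one p q v w \<in> finite_rank_part (graph_algebra G)"
proof -
  have "(complex_rank_one p q v w x, complex_rank_one p q v w y) \<in> G" if "(x, y) \<in> G" for x y
  proof -
    have "p \<bullet> y = q \<bullet> x" "q \<bullet> y = - (p \<bullet> x)"
      using assms(1) that rotate[OF that] by (auto simp: dual_pair_def)
    then show ?thesis
      using graph_combination[OF assms(2) rotate[OF assms(2)], of "p \<bullet> x" "- (q \<bullet> x)"]
      by (simp add: algebra_simps)
  qed
  then show ?thesis
    by (auto simp: finite_rank_part_def graph_algebra_def finite_rank_complex_rank_one)
qed

text \<open>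
  Dual pairs are closed under multiplication by complex numbers, so a pair that does not vanish at
  \<open>x\<close> can be divided by its value there.
\<close>

lemma normalized_dual_pair:
  assumes "x \<noteq> 0"
  obtains p q where "dual_pair G p q" "p \<bullet> x = 1" "q \<bullet> x = 0"
proof -
  obtain p q where pq: "dual_pair G p q" "p \<bullet> x \<noteq> 0"
    using dual_pairs_separate[OF assms] by blast
  define a b where "a = p \<bullet> x" and "b = q \<bullet> x"
  define r where "r = a * a + b * b"
  have "r > 0"
    using pq(2) unfolding r_def a_def[symmetric]
    by (intro add_pos_nonneg) (auto simp: zero_less_mult_iff)
  have "dual_pair G ((a / r) *\<^sub>R p + (b / r) *\<^sub>R q) ((a / r) *\<^sub>R q - (b / r) *\<^sub>R p)"
    unfolding dual_pair_def
  proof clarify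
    fix y z assume "(y, z) \<in> G"
    then have "p \<bullet> z = q \<bullet> y" "q \<bullet> z = - (p \<bullet> y)"
      using pq(1) rotate[of y z] by (auto simp: dual_pair_def)
    then show "((a / r) *\<^sub>R p + (b / r) *\<^sub>R q) \<bullet> z = ((a / r) *\<^sub>R q - (b / r) *\<^sub>R p) \<bullet> y"
      by (simp add: inner_add_left inner_diff_left)
  qed
  moreover have "((a / r) *\<^sub>R p + (b / r) *\<^sub>R q) \<bullet> x = 1"
    using \<open>r > 0\<close> by (simp add: inner_add_left a_def[symmetric] b_def[symmetric] add_divide_distrib[symmetric])
      (simp add: r_def)
  moreover have "((a / r) *\<^sub>R q - (b / r) *\<^sub>R p) \<bullet> x = 0"
    by (simp add: inner_diff_left a_def[symmetric] b_def[symmetric])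
  ultimately show ?thesis
    by (rule that)
qed

lemma transitive_on_domain:
  assumes "x \<noteq> 0" "v \<in> Domain G"
  obtains T where "T \<in> finite_rank_part (graph_algebra G)" "compact_operator T" "blinfun_apply T x = v"
proof -
  obtain p q where pq: "dual_pair G p q" "p \<bullet> x = 1" "q \<bullet> x = 0"
    using normalized_dual_pair[OF assms(1)] .
  show ?thesis
    by (rule that[OF complex_rank_one_in_algebra[OF pq(1) graph_J[OF assms(2)]]
          compact_complex_rank_one]) (simp add: pq)
qed

lemma transitive_graph_algebra: "transitive_algebra (graph_algebra G)"
  unfolding transitive_algebra_def
proof (intro allI impI, elim conjE)
  fix M :: "'a set"
  assume M: "subspace M" "closed M" "\<forall>T\<in>graph_algebra G. blinfun_apply T ` M \<subseteq> M"
  show "M = {0} \<or> M = UNIV"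
  proof (cases "\<exists>x\<in>M. x \<noteq> 0")
    case True
    then obtain x where x: "x \<in> M" "x \<noteq> 0"
      by blast
    have "v \<in> M" if "v \<in> Domain G" for v
    proof (rule transitive_on_domain[OF x(2) that])
      fix T assume "T \<in> finite_rank_part (graph_algebra G)" "blinfun_apply T x = v"
      then show "v \<in> M"
        using M(3) x(1) by (auto simp: finite_rank_part_def)
    qed
    then have "closure (Domain G) \<subseteq> M"
      using M(2) by (intro closure_minimal) auto
    then show ?thesis
      using dense_domain by auto
  next
    case False
    then show ?thesis
      using subspace_0[OF M(1)] by auto
  qed
qed

lemma lomonosov_graph_algebra: "lomonosov_algebra (graph_algebra G)"
proof -
  obtain x y where x: "(x, y) \<in> G" "x \<noteq> 0"
    using nontrivial by blast
  obtain T where T: "T \<in> finite_rank_part (graph_algebra G)" "compact_operator T"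
      "blinfun_apply T x = x"
    using transitive_on_domain[OF x(2)] x(1) by blast
  then have "\<exists>T\<in>graph_algebra G. compact_operator T \<and> T \<noteq> 0"
    using x(2) by (intro bexI[of _ T]) (auto simp: finite_rank_part_def)
  then show ?thesis
    unfolding lomonosov_algebra_def
    by (simp add: operator_subalgebra_graph_algebra subspace_graph closedin_graph_algebra
        closed_graph transitive_graph_algebra)
qed

text \<open>
  The range of a finite-rank \<open>T\<close> in the algebra cannot leave the domain of \<open>J\<close>: the image of the
  domain under \<open>T\<close> is finite-dimensional, hence closed, and it is dense in the range of \<open>T\<close>.
\<close>

lemma finite_rank_space_graph_algebra: "finite_rank_space (graph_algebra G) = Domain G"
proof (intro equalityI subsetI)
  fix v assume v: "v \<in> Domain G"
  obtain x y where x: "(x, y) \<in> G" "x \<noteq> 0"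
    using nontrivial by blast
  obtain T where "T \<in> finite_rank_part (graph_algebra G)" "blinfun_apply T x = v"
    using transitive_on_domain[OF x(2) v] by blast
  then show "v \<in> finite_rank_space (graph_algebra G)"
    unfolding finite_rank_space_def by (intro span_base) blast
next
  have "T x \<in> Domain G" if T: "T \<in> finite_rank_part (graph_algebra G)" for T x
  proof -
    have "linear T"
      by (intro bounded_linear.linear blinfun.bounded_linear_right)
    obtain B where B: "finite B" "span B = range T"
      using T by (auto simp: finite_rank_part_def finite_rank_operator_def
          finite_dimensional_space_def)
    have "finite_dimensional_space (T ` Domain G)"
      using B by (intro finite_dimensional_space_subspace[of _ B] linear_subspace_image
          \<open>linear T\<close> subspace_domain) auto
    then have "closed (T ` Domain G)"
      using closed_span_finite by (metis finite_dimensional_space_def)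
    moreover have "T x \<in> T ` closure (Domain G)"
      by (simp add: dense_domain)
    moreover have "T ` closure (Domain G) \<subseteq> closure (T ` Domain G)"
      by (intro image_closure_subset[OF _ closed_closure closure_subset])
        (intro linear_continuous_on blinfun.bounded_linear_right)
    ultimately have "T x \<in> T ` Domain G"
      by (auto simp: closure_closed)
    also have "T ` Domain G \<subseteq> Domain G"
      using T graph_algebraD by (fastforce simp: finite_rank_part_def)
    finally show ?thesis .
  qed
  then have "{blinfun_apply T x | T x. T \<in> finite_rank_part (graph_algebra G)} \<subseteq> Domain G"
    by blast
  then have "finite_rank_space (graph_algebra G) \<subseteq> Domain G"
    unfolding finite_rank_space_def by (intro span_minimal subspace_domain)
  then show "v \<in> Domain G" if "v \<in> finite_rank_space (graph_algebra G)" for v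
    using that by blast
qed

text \<open>
  Fix \<open>x\<close> in the domain and a dual pair normalized at \<open>x\<close>. The operator \<open>R\<^sub>v\<close> of complex rank one
  with this pair maps \<open>x\<close> to \<open>v\<close>, so \<open>S v = S R\<^sub>v x = R\<^sub>v (S x)\<close>, and the last vector is a combination
  of \<open>v\<close> and \<open>J v\<close> whose coefficients depend on \<open>S x\<close> only.
\<close>

lemma commuting_map_is_combination:
  assumes range: "\<And>x. x \<in> Domain G \<Longrightarrow> S x \<in> Domain G"
    and commute: "\<And>T x. T \<in> finite_rank_part (graph_algebra G) \<Longrightarrow> x \<in> Domain G \<Longrightarrow>
      S (blinfun_apply T x) = T (S x)"
  obtains a b where "\<And>x. x \<in> Domain G \<Longrightarrow> S x = a *\<^sub>R x + b *\<^sub>R J x"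
proof -
  obtain x y where x: "(x, y) \<in> G" "x \<noteq> 0"
    using nontrivial by blast
  obtain p q where pq: "dual_pair G p q" "p \<bullet> x = 1" "q \<bullet> x = 0"
    using normalized_dual_pair[OF x(2)] .
  have "S v = (p \<bullet> S x) *\<^sub>R v + (- (q \<bullet> S x)) *\<^sub>R J v" if "v \<in> Domain G" for v
    using commute[OF complex_rank_one_in_algebra[OF pq(1) graph_J[OF that]], of x] x(1)
    by (auto simp: pq)
  then show ?thesis
    by (rule that)
qed

lemma complex_type_graph_algebra: "complex_type (graph_algebra G)"
proof -
  let ?D = "Domain G"
  define \<phi> where "\<phi> z = (\<lambda>x\<in>?D. Re z *\<^sub>R x + Im z *\<^sub>R J x)" for z
  have \<phi>_in: "\<phi> z x \<in> ?D" if "x \<in> ?D" for z x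
    using that combination_in_domain by (simp add: \<phi>_def)
  have J_add: "J (x + y) = J x + J y" if "x \<in> ?D" "y \<in> ?D" for x y
    using J_combination[OF that, of 1 1] by simp
  have J_scale: "J (r *\<^sub>R x) = r *\<^sub>R J x" if "x \<in> ?D" for r x
    using J_combination[OF that that, of r 0] by simp
  have "\<phi> z \<in> commutant_algebra (graph_algebra G)" for z
    unfolding commutant_algebra_def finite_rank_space_graph_algebra mem_Collect_eq
  proof (intro conjI ballI allI)
    show "\<phi> z \<in> ?D \<rightarrow>\<^sub>E ?D"
      using \<phi>_in by (auto simp: \<phi>_def)
  next
    fix x y assume "x \<in> ?D" "y \<in> ?D"
    then show "\<phi> z (x + y) = \<phi> z x + \<phi> z y"
      by (simp add: \<phi>_def subspace_add[OF subspace_domain] J_add algebra_simps)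
  next
    fix r x assume "x \<in> ?D"
    then show "\<phi> z (r *\<^sub>R x) = r *\<^sub>R \<phi> z x"
      by (simp add: \<phi>_def subspace_scale[OF subspace_domain] J_scale algebra_simps)
  next
    fix T x assume "T \<in> finite_rank_part (graph_algebra G)" "x \<in> ?D"
    then have "(blinfun_apply T x, T (J x)) \<in> G"
      by (intro graph_algebraD graph_J) (auto simp: finite_rank_part_def)
    then have "blinfun_apply T x \<in> ?D" "J (T x) = T (J x)"
      using J_eq by auto
    with \<open>x \<in> ?D\<close> show "\<phi> z (T x) = T (\<phi> z x)"
      by (simp add: \<phi>_def blinfun.add_right blinfun.scaleR_right)
  qed
  moreover have "\<exists>z. S = \<phi> z" if S: "S \<in> commutant_algebra (graph_algebra G)" for S
  proof -
    have S': "S \<in> ?D \<rightarrow>\<^sub>E ?D"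
      and comm: "\<And>T x. T \<in> finite_rank_part (graph_algebra G) \<Longrightarrow> x \<in> ?D \<Longrightarrow>
        S (blinfun_apply T x) = T (S x)"
      using S by (auto simp: commutant_algebra_def finite_rank_space_graph_algebra)
    obtain a b where ab: "\<And>x. x \<in> ?D \<Longrightarrow> S x = a *\<^sub>R x + b *\<^sub>R J x"
      using commuting_map_is_combination[of S] S' comm by (metis PiE_mem)
    have "S = \<phi> (Complex a b)"
    proof
      fix x show "S x = \<phi> (Complex a b) x"
        using ab S' by (cases "x \<in> ?D") (auto simp: \<phi>_def PiE_def extensional_def)
    qed
    then show ?thesis ..
  qed
  moreover have "inj \<phi>"
  proof (rule injI)
    fix z w assume eq: "\<phi> z = \<phi> w"
    obtain x y where x: "(x, y) \<in> G" "x \<noteq> 0"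
      using nontrivial by blast
    then have "x \<in> ?D"
      by blast
    then show "z = w"
      using fun_cong[OF eq, of x] combination_eq_iff[OF _ x(2)]
      by (simp add: \<phi>_def complex_eq_iff)
  qed
  ultimately have "bij_betw \<phi> UNIV (commutant_algebra (graph_algebra G))"
    unfolding bij_betw_def by blast
  moreover have "\<phi> (z * w) x = \<phi> z (\<phi> w x)" if "x \<in> ?D" for z w x
    using that by (simp add: \<phi>_def combination_in_domain J_combination J_in_domain J_J algebra_simps)
  ultimately have "commutant_isomorphism (graph_algebra G) \<phi>"
    unfolding commutant_isomorphism_def finite_rank_space_graph_algebra
    by (auto simp: \<phi>_def algebra_simps)
  then show ?thesis
    unfolding complex_type_def by blast
qed

end

section \<open>Similarities intertwine the complex structures\<close>

lemma similar_finite_rank_part: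
  fixes T T' :: "'a::banach \<Rightarrow>\<^sub>L 'a"
  assumes inv: "T o\<^sub>L T' = id_blinfun" "T' o\<^sub>L T = id_blinfun"
    and AB: "(\<lambda>S. T o\<^sub>L S o\<^sub>L T') ` A = B"
    and R: "R \<in> finite_rank_part A"
  shows "T o\<^sub>L R o\<^sub>L T' \<in> finite_rank_part B"
proof -
  have T'_T: "T' (T x) = x" and T_T': "T (T' x) = x" for x
    using inv by (metis blinfun_apply_blinfun_compose id_blinfun.rep_eq id_apply)+
  have range: "range (T o\<^sub>L R o\<^sub>L T') = T ` range R"
  proof (intro equalityI subsetI)
    fix y assume "y \<in> T ` range R"
    then obtain x where "y = (T o\<^sub>L R o\<^sub>L T') (T x)"
      using T'_T by auto
    then show "y \<in> range (T o\<^sub>L R o\<^sub>L T')"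
      by blast
  qed auto
  have "finite_dimensional_space (T ` range R)"
    by (rule finite_dimensional_space_image[OF bounded_linear.linear[OF blinfun.bounded_linear_right]])
      (use R in \<open>simp add: finite_rank_part_def finite_rank_operator_def\<close>)
  then have "finite_rank_operator (T o\<^sub>L R o\<^sub>L T')"
    unfolding finite_rank_operator_def range .
  moreover have "T o\<^sub>L R o\<^sub>L T' \<in> B"
    using R AB by (auto simp: finite_rank_part_def)
  ultimately show ?thesis
    by (simp add: finite_rank_part_def)
qed

lemma similar_sym:
  fixes T T' :: "'a::banach \<Rightarrow>\<^sub>L 'a"
  assumes inv: "T o\<^sub>L T' = id_blinfun" "T' o\<^sub>L T = id_blinfun"
    and AB: "(\<lambda>S. T o\<^sub>L S o\<^sub>L T') ` A = B"
  shows "(\<lambda>S. T' o\<^sub>L S o\<^sub>L T) ` B = A"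
proof -
  have T'_T: "T' (T x) = x" for x
    using inv by (metis blinfun_apply_blinfun_compose id_blinfun.rep_eq id_apply)
  have "T' o\<^sub>L (T o\<^sub>L S o\<^sub>L T') o\<^sub>L T = S" for S
    by (rule blinfun_eqI) (simp add: T'_T)
  then show ?thesis
    unfolding AB[symmetric] by (simp add: image_image)
qed

lemma similar_finite_rank_space:
  fixes T T' :: "'a::banach \<Rightarrow>\<^sub>L 'a"
  assumes inv: "T o\<^sub>L T' = id_blinfun" "T' o\<^sub>L T = id_blinfun"
    and AB: "(\<lambda>S. T o\<^sub>L S o\<^sub>L T') ` A = B"
    and x: "x \<in> finite_rank_space A"
  shows "T x \<in> finite_rank_space B"
proof -
  have T'_T: "T' (T x) = x" for x
    using inv by (metis blinfun_apply_blinfun_compose id_blinfun.rep_eq id_apply)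
  have "linear T"
    by (intro bounded_linear.linear blinfun.bounded_linear_right)
  let ?X = "\<lambda>A. {blinfun_apply R x | R x. R \<in> finite_rank_part A}"
  have "T ` ?X A \<subseteq> ?X B"
  proof clarify
    fix R x assume "R \<in> finite_rank_part A"
    then have "T o\<^sub>L R o\<^sub>L T' \<in> finite_rank_part B"
      by (rule similar_finite_rank_part[OF inv AB])
    moreover have "T (R x) = (T o\<^sub>L R o\<^sub>L T') (T x)"
      by (simp add: T'_T)
    ultimately show "\<exists>S y. T (R x) = blinfun_apply S y \<and> S \<in> finite_rank_part B"
      by blast
  qed
  then have "T ` span (?X A) \<subseteq> span (?X B)"
    unfolding linear_span_image[OF \<open>linear T\<close>, symmetric] by (rule span_mono)
  then show ?thesis
    using x by (auto simp: finite_rank_space_def)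
qed

text \<open>
  The map \<open>S = T J\<^sub>G T\<^sup>-\<^sup>1\<close> commutes with the finite-rank operators in the algebra of \<open>H\<close>, so it equals
  \<open>a + b J\<^sub>H\<close>, and \<open>S\<^sup>2 = -1\<close> leaves only \<open>\<plusminus> J\<^sub>H\<close>.
\<close>

lemma similarity_intertwines:
  fixes T T' :: "'a::{real_inner, banach} \<Rightarrow>\<^sub>L 'a"
  assumes "closed_complex_structure G" "closed_complex_structure H"
    and inv: "T o\<^sub>L T' = id_blinfun" "T' o\<^sub>L T = id_blinfun"
    and sim: "(\<lambda>S. T o\<^sub>L S o\<^sub>L T') ` graph_algebra G = graph_algebra H"
  obtains s where "\<bar>s\<bar> = 1" "\<And>x y. (x, y) \<in> G \<Longrightarrow> (T x, s *\<^sub>R T y) \<in> H"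
proof -
  interpret G: closed_complex_structure G by fact
  interpret H: closed_complex_structure H by fact
  have T'_T: "T' (T x) = x" and T_T': "T (T' x) = x" for x
    using inv by (metis blinfun_apply_blinfun_compose id_blinfun.rep_eq id_apply)+
  have T_dom: "T x \<in> Domain H" if "x \<in> Domain G" for x
    using similar_finite_rank_space[OF inv sim, of x] that
    by (simp add: G.finite_rank_space_graph_algebra H.finite_rank_space_graph_algebra)
  have T'_dom: "T' x \<in> Domain G" if "x \<in> Domain H" for x
    using similar_finite_rank_space[OF inv(2,1) similar_sym[OF inv sim], of x] that
    by (simp add: G.finite_rank_space_graph_algebra H.finite_rank_space_graph_algebra)
  define S where "S x = T (G.J (T' x))" for x
  have S_dom: "S x \<in> Domain H" if "x \<in> Domain H" for x
    unfolding S_def using that by (intro T_dom G.J_in_domain T'_dom)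
  have S_S: "S (S x) = - x" if "x \<in> Domain H" for x
    unfolding S_def using that by (simp add: T'_T T_T' G.J_J T'_dom blinfun.minus_right)
  have "S (R x) = R (S x)" if R: "R \<in> finite_rank_part (graph_algebra H)" and x: "x \<in> Domain H"
    for R x
  proof -
    define Q where "Q = T' o\<^sub>L R o\<^sub>L T"
    have "Q \<in> graph_algebra G"
      using similar_finite_rank_part[OF inv(2,1) similar_sym[OF inv sim] R]
      by (simp add: finite_rank_part_def Q_def)
    then have "G.J (Q (T' x)) = Q (G.J (T' x))"
      using x by (intro G.J_eq graph_algebraD G.graph_J T'_dom)
    then show ?thesis
      by (simp add: S_def Q_def T_T')
  qed
  then obtain a b where ab: "\<And>x. x \<in> Domain H \<Longrightarrow> S x = a *\<^sub>R x + b *\<^sub>R H.J x"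
    using H.commuting_map_is_combination[of S] S_dom by metis
  obtain x where x: "x \<in> Domain H" "x \<noteq> 0"
    using H.nontrivial by blast
  \<comment> \<open>Reading \<open>J\<close> as \<open>i\<close>, this is \<open>(a + i b)\<^sup>2 = -1\<close> for real \<open>a\<close>, \<open>b\<close>.\<close>
  have "S (S x) = (a * a - b * b) *\<^sub>R x + (2 * a * b) *\<^sub>R H.J x"
    using x(1) S_dom[OF x(1)]
    by (simp add: ab H.J_combination H.J_in_domain H.J_J algebra_simps)
      (simp add: scaleR_add_left[symmetric])
  then have "(a * a - b * b) *\<^sub>R x + (2 * a * b) *\<^sub>R H.J x = (- 1) *\<^sub>R x + 0 *\<^sub>R H.J x"
    using S_S[OF x(1)] by simp
  then have "a * a - b * b = - 1" "2 * a * b = 0"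
    using H.combination_eq_iff[OF x] by blast+
  moreover have "- 1 < a * a"
    using zero_le_square[of a] by linarith
  ultimately have "a = 0" "b * b = 1"
    by auto
  have "(T x, b *\<^sub>R T y) \<in> H" if "(x, y) \<in> G" for x y
  proof -
    have x: "x \<in> Domain G"
      using that by blast
    have "T y = b *\<^sub>R H.J (T x)"
      using ab[OF T_dom[OF x]] G.J_eq[OF that] \<open>a = 0\<close> by (simp add: S_def T'_T)
    then have "b *\<^sub>R T y = H.J (T x)"
      using \<open>b * b = 1\<close> by simp
    then show ?thesis
      using H.graph_J[OF T_dom[OF x]] by simp
  qed
  moreover have "\<bar>b\<bar> = 1"
    using abs_square_eq_1[of b] \<open>b * b = 1\<close> by (simp add: power2_eq_square)
  ultimately show ?thesis
    using that by blast
qed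

section \<open>Weighted complex structures\<close>

text \<open>
  The graph of the closed operator with \<open>J e\<^bsub>2n\<^esub> = l\<^sub>n e\<^bsub>2n+1\<^esub>\<close> and \<open>J e\<^bsub>2n+1\<^esub> = - e\<^bsub>2n\<^esub> / l\<^sub>n\<close>, given by
  equations between coordinates. In this form it is visibly closed, and the domain is the largest
  possible one.
\<close>

definition weighted_graph ::
  "(nat \<Rightarrow> 'a::real_inner) \<Rightarrow> (nat \<Rightarrow> real) \<Rightarrow> ('a \<times> 'a) set" where
  "weighted_graph e l =
     {(x, y). \<forall>n. y \<bullet> e (2 * n + 1) = l n * (x \<bullet> e (2 * n)) \<and>
                  l n * (y \<bullet> e (2 * n)) = - (x \<bullet> e (2 * n + 1))}"

lemma orthogonal_to_basis_imp_0:
  fixes e :: "nat \<Rightarrow> 'a::real_inner"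
  assumes "orthonormal_sequence e" "closure (span (range e)) = UNIV"
    and "\<And>n. x \<bullet> e n = 0"
  shows "x = 0"
  using orthonormal_expansion[OF assms(1,2), of x] sums_unique2[OF _ sums_zero] by (simp add: assms(3))

lemma orthogonal_to_pairs_imp_0:
  fixes e :: "nat \<Rightarrow> 'a::real_inner"
  assumes "orthonormal_sequence e" "closure (span (range e)) = UNIV"
    and "\<And>n. x \<bullet> e (2 * n) = 0" "\<And>n. x \<bullet> e (2 * n + 1) = 0"
  shows "x = 0"
proof (rule orthogonal_to_basis_imp_0[OF assms(1,2)])
  show "x \<bullet> e n = 0" for n
    using assms(3)[of "n div 2"] assms(4)[of "n div 2"] by (cases "even n") simp_all
qed

lemma basis_pair_in_weighted_graph:
  assumes "orthonormal_sequence e" "\<And>n. l n \<noteq> 0"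
  shows "(e (2 * n), l n *\<^sub>R e (2 * n + 1)) \<in> weighted_graph e l"
    and "(e (2 * n + 1), (- inverse (l n)) *\<^sub>R e (2 * n)) \<in> weighted_graph e l"
  using assms
  by (auto simp: weighted_graph_def orthonormal_sequence_def Suc_double_not_eq_double
      double_not_eq_Suc_double)

lemma closed_complex_structure_weighted_graph:
  fixes e :: "nat \<Rightarrow> 'a::{real_inner, banach}"
  assumes e: "orthonormal_sequence e" "closure (span (range e)) = UNIV"
    and l: "\<And>n. l n \<noteq> 0"
  shows "closed_complex_structure (weighted_graph e l)"
proof
  show subspace: "subspace (weighted_graph e l)"
    by (auto simp: weighted_graph_def zero_prod_def inner_add_left algebra_simps intro!: subspaceI)
  show "closed (weighted_graph e l)"
    unfolding weighted_graph_def case_prod_unfold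
    by (intro closed_Collect_all closed_Collect_conj closed_Collect_eq continuous_intros)
  show "y = 0" if "(0, y) \<in> weighted_graph e l" for y
    using that l by (intro orthogonal_to_pairs_imp_0[OF e]) (auto simp: weighted_graph_def)
  show "(y, - x) \<in> weighted_graph e l" if "(x, y) \<in> weighted_graph e l" for x y
    using that by (auto simp: weighted_graph_def)
  have "subspace (Domain (weighted_graph e l))"
    using linear_subspace_image[OF bounded_linear.linear[OF bounded_linear_fst] subspace]
    by (simp add: Domain_fst)
  moreover have "e n \<in> Domain (weighted_graph e l)" for n
    using basis_pair_in_weighted_graph[OF e(1), of l "n div 2"] l
    by (cases "even n") (auto simp del: scaleR_minus_left)
  ultimately have "span (range e) \<subseteq> Domain (weighted_graph e l)"
    by (intro span_minimal) auto
  then show "closure (Domain (weighted_graph e l)) = UNIV"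
    using e(2) closure_mono by blast
  show "\<exists>p q. dual_pair (weighted_graph e l) p q \<and> p \<bullet> x \<noteq> 0" if "x \<noteq> 0" for x
  proof -
    have "dual_pair (weighted_graph e l) (e (2 * n)) ((- inverse (l n)) *\<^sub>R e (2 * n + 1))"
        "dual_pair (weighted_graph e l) (e (2 * n + 1)) (l n *\<^sub>R e (2 * n))" for n
      using l[of n] by (auto simp: dual_pair_def weighted_graph_def inner_commute field_simps)
    then show ?thesis
      using orthogonal_to_pairs_imp_0[OF e, of x] that by (metis inner_commute)
  qed
  have "e 0 \<noteq> 0"
    using e(1) unfolding orthonormal_sequence_def by (metis inner_zero_left zero_neq_one)
  then show "\<exists>x y. (x, y) \<in> weighted_graph e l \<and> x \<noteq> 0"
    using basis_pair_in_weighted_graph(1)[OF e(1), of l 0] l by auto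
qed

lemma matrix_entry_bound:
  fixes T :: "'a::real_inner \<Rightarrow>\<^sub>L 'a"
  assumes "orthonormal_sequence e"
  shows "\<bar>T (e i) \<bullet> e j\<bar> \<le> norm T"
proof -
  have unit: "norm (e n) = 1" for n
    using assms by (simp add: orthonormal_sequence_def norm_eq_1)
  have "\<bar>T (e i) \<bullet> e j\<bar> \<le> norm (T (e i)) * norm (e j)"
    by (rule Cauchy_Schwarz_ineq2)
  also have "\<dots> \<le> norm T"
    using norm_blinfun[of T "e i"] by (simp add: unit)
  finally show ?thesis .
qed

text \<open>
  Comparing coordinates in \<open>T J\<^sub>l e\<^bsub>2n\<^esub> = \<plusminus> J\<^sub>m T e\<^bsub>2n\<^esub>\<close> expresses each of these entries by another
  entry of \<open>T\<close> times a factor made of weights, and every entry is at most \<open>\<parallel>T\<parallel>\<close>.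
\<close>

lemma intertwiner_entry_bounds:
  fixes T :: "'a::{real_inner, banach} \<Rightarrow>\<^sub>L 'a"
  assumes e: "orthonormal_sequence e"
    and l: "\<And>n. l n > 0" and m: "\<And>n. m n > 0"
    and s: "\<bar>s\<bar> = 1"
    and T: "\<And>x y. (x, y) \<in> weighted_graph e l \<Longrightarrow> (T x, s *\<^sub>R T y) \<in> weighted_graph e m"
  shows "\<bar>T (e (2 * n)) \<bullet> e (2 * k)\<bar> \<le> l n / m k * norm T"
    and "\<bar>T (e (2 * n + 1)) \<bullet> e (2 * k)\<bar> \<le> 1 / (l n * m k) * norm T"
proof -
  have l0: "l n \<noteq> 0" for n
    using l[of n] by simp
  have "(T (e (2 * n)), s *\<^sub>R T (l n *\<^sub>R e (2 * n + 1))) \<in> weighted_graph e m"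
    by (intro T basis_pair_in_weighted_graph e l0)
  then have eq: "s * (l n * (T (e (2 * n + 1)) \<bullet> e (2 * k + 1))) = m k * (T (e (2 * n)) \<bullet> e (2 * k))"
      "m k * (s * (l n * (T (e (2 * n + 1)) \<bullet> e (2 * k)))) = - (T (e (2 * n)) \<bullet> e (2 * k + 1))"
    by (simp_all add: weighted_graph_def blinfun.scaleR_right mult.assoc)
  have "m k * \<bar>T (e (2 * n)) \<bullet> e (2 * k)\<bar> = l n * \<bar>T (e (2 * n + 1)) \<bullet> e (2 * k + 1)\<bar>"
    using arg_cong[OF eq(1), of abs] l[of n] m[of k] s by (simp add: abs_mult)
  then show "\<bar>T (e (2 * n)) \<bullet> e (2 * k)\<bar> \<le> l n / m k * norm T"
    using matrix_entry_bound[OF e, of T "2 * n + 1" "2 * k + 1"] l[of n] m[of k]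
    by (simp add: field_simps)
  have "m k * (l n * \<bar>T (e (2 * n + 1)) \<bullet> e (2 * k)\<bar>) = \<bar>T (e (2 * n)) \<bullet> e (2 * k + 1)\<bar>"
    using arg_cong[OF eq(2), of abs] l[of n] m[of k] s by (simp add: abs_mult)
  then show "\<bar>T (e (2 * n + 1)) \<bullet> e (2 * k)\<bar> \<le> 1 / (l n * m k) * norm T"
    using matrix_entry_bound[OF e, of T "2 * n" "2 * k + 1"] l[of n] m[of k]
    by (simp add: field_simps)
qed

text \<open>
  The \<open>2k\<close>-th diagonal entry of \<open>T S = 1\<close> is \<open>1\<close>, and expanding \<open>S e\<^bsub>2k\<^esub>\<close> in the basis writes it
  as a sum of products of entries, two of them for each \<open>n\<close>.
\<close>

lemma diagonal_entry_bound:
  fixes S T :: "'a::real_inner \<Rightarrow>\<^sub>L 'a"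
  assumes e: "orthonormal_sequence e" "closure (span (range e)) = UNIV"
    and inv: "\<And>x. T (S x) = x"
    and bound: "\<And>n. \<bar>(S (e (2 * k)) \<bullet> e (2 * n)) * (T (e (2 * n)) \<bullet> e (2 * k))\<bar> \<le> f n"
      "\<And>n. \<bar>(S (e (2 * k)) \<bullet> e (2 * n + 1)) * (T (e (2 * n + 1)) \<bullet> e (2 * k))\<bar> \<le> f n"
    and f: "f sums F"
  shows "1 \<le> 2 * F"
proof -
  define c where "c n = (S (e (2 * k)) \<bullet> e n) * (T (e n) \<bullet> e (2 * k))" for n
  have "(\<lambda>n. T ((S (e (2 * k)) \<bullet> e n) *\<^sub>R e n) \<bullet> e (2 * k)) sums (T (S (e (2 * k))) \<bullet> e (2 * k))"
    by (intro bounded_linear.sums[OF bounded_linear_inner_left]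
        bounded_linear.sums[OF blinfun.bounded_linear_right] orthonormal_expansion e)
  then have "c sums 1"
    using e(1) by (simp add: c_def[abs_def] inv blinfun.scaleR_right orthonormal_sequence_def)
  then have c_limit: "(\<lambda>N. \<Sum>n<2 * N. c n) \<longlonglongrightarrow> 1"
    unfolding sums_def by (rule filterlim_compose) (intro filterlim_subseq strict_monoI; simp)
  have f_limit: "(\<lambda>N. \<Sum>n<N. 2 * f n) \<longlonglongrightarrow> 2 * F"
    using sums_mult[OF f, of 2] by (simp add: sums_def)
  have partial_sums: "(\<Sum>n<2 * N. c n) \<le> (\<Sum>n<N. 2 * f n)" for N
  proof (induction N)
    case (Suc N)
    have "c (2 * N) + c (2 * N + 1) \<le> 2 * f N"
      using bound[of N] by (simp add: c_def)
    then show ?case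
      using Suc by simp
  qed simp
  show ?thesis
    by (rule LIMSEQ_le[OF c_limit f_limit]) (intro exI allI impI partial_sums)
qed

text \<open>
  An entry of a similarity between even basis vectors and the opposite entry of its inverse have a
  product bounded by both quotients of the two weights, hence by the smaller one; the entries that
  involve an odd vector give \<open>1 / (l\<^sub>n m\<^sub>k)\<close>. The exponential bounds make the sum over \<open>n\<close> a geometric
  series that is of order \<open>exp (- \<delta> k)\<close>, so for large \<open>k\<close> it cannot be \<open>1\<close>.
\<close>

lemma separated_weights_not_similar:
  fixes e :: "nat \<Rightarrow> 'a::{real_inner, banach}"
  assumes e: "orthonormal_sequence e" "closure (span (range e)) = UNIV"
    and l: "\<And>n. l n > 0" and m: "\<And>n. m n > 0"
    and "0 < \<delta>"
    and ratio: "\<And>n k. min (l n / m k) (m k / l n) \<le> exp (- \<delta> * (real n + real k))"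
    and product: "\<And>n k. 1 / (l n * m k) \<le> exp (- \<delta> * (real n + real k))"
  shows "\<not> similar_algebras (graph_algebra (weighted_graph e l)) (graph_algebra (weighted_graph e m))"
proof
  assume "similar_algebras (graph_algebra (weighted_graph e l)) (graph_algebra (weighted_graph e m))"
  then obtain T T' where inv: "T o\<^sub>L T' = id_blinfun" "T' o\<^sub>L T = id_blinfun"
    and sim: "(\<lambda>S. T o\<^sub>L S o\<^sub>L T') ` graph_algebra (weighted_graph e l) =
      graph_algebra (weighted_graph e m)"
    unfolding similar_algebras_def by blast
  have graphs: "closed_complex_structure (weighted_graph e l)"
      "closed_complex_structure (weighted_graph e m)"
    using l m by (intro closed_complex_structure_weighted_graph e; metis less_irrefl)+
  obtain s where s: "\<bar>s\<bar> = 1"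
      "\<And>x y. (x, y) \<in> weighted_graph e l \<Longrightarrow> (T x, s *\<^sub>R T y) \<in> weighted_graph e m"
    using similarity_intertwines[OF graphs inv sim] by blast
  obtain s' where s': "\<bar>s'\<bar> = 1"
      "\<And>x y. (x, y) \<in> weighted_graph e m \<Longrightarrow> (T' x, s' *\<^sub>R T' y) \<in> weighted_graph e l"
    using similarity_intertwines[OF graphs(2,1) inv(2,1) similar_sym[OF inv sim]] by blast
  define C where "C = norm T * norm T'"
  have C: "0 \<le> C"
    by (simp add: C_def)
  define f where "f k n = C * (exp (- \<delta> * real k) * exp (- \<delta>) ^ n)" for k n :: nat
  have f: "f k n = C * exp (- \<delta> * (real n + real k))" for k n
    by (simp add: f_def exp_of_nat_mult[symmetric] exp_add[symmetric] algebra_simps)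
  have T_T': "T (T' x) = x" for x
    using inv by (metis blinfun_apply_blinfun_compose id_blinfun.rep_eq id_apply)
  have even: "\<bar>(T' (e (2 * k)) \<bullet> e (2 * n)) * (T (e (2 * n)) \<bullet> e (2 * k))\<bar> \<le> f k n" for n k
  proof -
    let ?t = "\<bar>T (e (2 * n)) \<bullet> e (2 * k)\<bar>" and ?t' = "\<bar>T' (e (2 * k)) \<bullet> e (2 * n)\<bar>"
    have t: "?t \<le> l n / m k * norm T" "?t \<le> norm T"
      by (rule intertwiner_entry_bounds(1)[OF e(1) l m s]) (assumption, rule matrix_entry_bound[OF e(1)])
    have t': "?t' \<le> m k / l n * norm T'" "?t' \<le> norm T'"
      by (rule intertwiner_entry_bounds(1)[OF e(1) m l s']) (assumption, rule matrix_entry_bound[OF e(1)])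
    have "?t' * ?t \<le> norm T' * (l n / m k * norm T)" "?t' * ?t \<le> m k / l n * norm T' * norm T"
      by (intro mult_mono t t'; use l[of n] m[of k] in simp)+
    then have "?t' * ?t \<le> C * min (l n / m k) (m k / l n)"
      by (simp add: C_def min_def mult_ac)
    also have "\<dots> \<le> f k n"
      unfolding f by (intro mult_left_mono ratio C)
    finally show ?thesis
      by (simp add: abs_mult)
  qed
  have odd: "\<bar>(T' (e (2 * k)) \<bullet> e (2 * n + 1)) * (T (e (2 * n + 1)) \<bullet> e (2 * k))\<bar> \<le> f k n" for n k
  proof -
    have "\<bar>T' (e (2 * k)) \<bullet> e (2 * n + 1)\<bar> * \<bar>T (e (2 * n + 1)) \<bullet> e (2 * k)\<bar>
        \<le> norm T' * (1 / (l n * m k) * norm T)"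
      by (intro mult_mono intertwiner_entry_bounds[OF e(1) l m s] matrix_entry_bound[OF e(1)]) auto
    also have "\<dots> = C * (1 / (l n * m k))"
      by (simp add: C_def)
    also have "\<dots> \<le> f k n"
      unfolding f by (intro mult_left_mono product C)
    finally show ?thesis
      by (simp add: abs_mult)
  qed
  define F where "F k = C * (exp (- \<delta> * real k) * (1 / (1 - exp (- \<delta>))))" for k :: nat
  have "f k sums F k" for k
    unfolding f_def F_def using \<open>0 < \<delta>\<close> by (intro sums_mult geometric_sums) simp
  then have lower: "1 \<le> 2 * F k" for k
    by (rule diagonal_entry_bound[OF e T_T' even odd])
  have limit: "(\<lambda>k. 2 * F k) \<longlonglongrightarrow> 0"
  proof -
    have "(\<lambda>k. exp (- \<delta>) ^ k) \<longlonglongrightarrow> 0"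
      using \<open>0 < \<delta>\<close> by (intro LIMSEQ_realpow_zero) auto
    then have "(\<lambda>k. exp (- \<delta> * real k)) \<longlonglongrightarrow> 0"
      by (simp add: exp_of_nat_mult[symmetric] mult.commute)
    then show ?thesis
      unfolding F_def by (intro tendsto_mult_right_zero tendsto_mult_left_zero)
  qed
  have "1 \<le> (0::real)"
    by (rule LIMSEQ_le_const[OF limit]) (intro exI allI impI lower)
  then show False
    by simp
qed

section \<open>A continuum of pairwise separated weights\<close>

definition shifted_square_weight :: "real \<Rightarrow> nat \<Rightarrow> real" where
  "shifted_square_weight s n = exp ((real n + s)\<^sup>2)"

text \<open>
  The logarithms of two weights are \<open>a\<^sup>2\<close> and \<open>b\<^sup>2\<close> with \<open>a = n + s\<close>, \<open>b = k + t\<close>, and they differ by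
  \<open>\<bar>a - b\<bar> (a + b)\<close>. Here \<open>\<bar>a - b\<bar>\<close> is at least the distance \<open>\<delta>\<close> of \<open>s - t\<close> to the integers. Squares
  in the exponent are what makes the gap grow with \<open>n + k\<close>.
\<close>

lemma shifted_square_weights_separated:
  assumes "0 < s" "s < 1" "0 < t" "t < 1" "s \<noteq> t"
  defines "\<delta> \<equiv> min \<bar>s - t\<bar> (1 - \<bar>s - t\<bar>)"
  shows "0 < \<delta>"
    and "min (shifted_square_weight s n / shifted_square_weight t k)
           (shifted_square_weight t k / shifted_square_weight s n) \<le> exp (- \<delta> * (real n + real k))"
    and "1 / (shifted_square_weight s n * shifted_square_weight t k) \<le> exp (- \<delta> * (real n + real k))"
proof -
  show "0 < \<delta>"
    using assms by (auto simp: \<delta>_def)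
  have "\<delta> \<le> 1"
    using assms by (auto simp: \<delta>_def)
  define a b where "a = real n + s" and "b = real k + t"
  have ab: "real n \<le> a" "real k \<le> b"
    using assms by (auto simp: a_def b_def)
  have "\<delta> \<le> \<bar>a - b\<bar>"
  proof (cases "n = k")
    case True
    then show ?thesis
      by (simp add: a_def b_def \<delta>_def)
  next
    case False
    then have "1 \<le> \<bar>real n - real k\<bar>"
      by linarith
    then show ?thesis
      unfolding a_def b_def \<delta>_def by linarith
  qed
  then have "\<delta> * (real n + real k) \<le> \<bar>a - b\<bar> * (a + b)"
    using ab \<open>0 < \<delta>\<close> by (intro mult_mono) auto
  also have "\<dots> = \<bar>a\<^sup>2 - b\<^sup>2\<bar>"
    using ab by (simp add: power2_eq_square square_diff_square_factored abs_mult mult.commute)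
  finally have "min (exp (a\<^sup>2 - b\<^sup>2)) (exp (b\<^sup>2 - a\<^sup>2)) \<le> exp (- \<delta> * (real n + real k))"
    by (auto simp: min_le_iff_disj)
  then show "min (shifted_square_weight s n / shifted_square_weight t k)
      (shifted_square_weight t k / shifted_square_weight s n) \<le> exp (- \<delta> * (real n + real k))"
    by (simp add: shifted_square_weight_def exp_diff a_def b_def)
  have square: "real i \<le> c\<^sup>2" if "real i \<le> c" for i c
  proof -
    have "real i \<le> (real i)\<^sup>2"
      by (cases i) (auto simp: power2_eq_square)
    also have "\<dots> \<le> c\<^sup>2"
      using that by (intro power_mono) auto
    finally show ?thesis .
  qed
  have "\<delta> * (real n + real k) \<le> 1 * (real n + real k)"
    using \<open>\<delta> \<le> 1\<close> by (intro mult_right_mono) auto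
  also have "\<dots> \<le> a\<^sup>2 + b\<^sup>2"
    using square[OF ab(1)] square[OF ab(2)] by simp
  finally have "inverse (exp (a\<^sup>2 + b\<^sup>2)) \<le> exp (- \<delta> * (real n + real k))"
    by (simp add: exp_minus[symmetric] del: exp_minus)
  then show "1 / (shifted_square_weight s n * shifted_square_weight t k) \<le> exp (- \<delta> * (real n + real k))"
    by (simp add: shifted_square_weight_def exp_add[symmetric] inverse_eq_divide a_def b_def)
qed

lemma similar_algebras_refl: "similar_algebras A A"
proof -
  have "id_blinfun o\<^sub>L S o\<^sub>L id_blinfun = S" for S :: "'a \<Rightarrow>\<^sub>L 'a"
    by (rule blinfun_eqI) simp
  then show ?thesis
    unfolding similar_algebras_def by (intro exI[of _ id_blinfun] conjI) (auto intro!: blinfun_eqI)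
qed

theorem corollary3p6:
  assumes "separable_space (euclidean :: 'h::{real_inner, banach} topology)"
    and "\<not> finite_dimensional_space (UNIV :: 'h set)"
  shows "\<exists>F :: ('h \<Rightarrow>\<^sub>L 'h) set set.
           F \<approx> (UNIV :: real set) \<and>
           (\<forall>A\<in>F. lomonosov_algebra A \<and> complex_type A) \<and>
           pairwise (\<lambda>A B. \<not> similar_algebras A B) F"
proof -
  obtain e :: "nat \<Rightarrow> 'h" where e: "orthonormal_sequence e" "closure (span (range e)) = UNIV"
    using orthonormal_basis_exists[OF assms] by blast
  define \<A> where "\<A> s = graph_algebra (weighted_graph e (shifted_square_weight s))" for s
  have pos: "0 < shifted_square_weight s n" for s n
    by (simp add: shifted_square_weight_def)
  have graphs: "closed_complex_structure (weighted_graph e (shifted_square_weight s))" for s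
    using pos by (intro closed_complex_structure_weighted_graph e) (metis less_irrefl)
  have not_similar: "\<not> similar_algebras (\<A> s) (\<A> t)"
    if "s \<in> {0<..<1}" "t \<in> {0<..<1}" "s \<noteq> t" for s t
  proof -
    have st: "0 < s" "s < 1" "0 < t" "t < 1" "s \<noteq> t"
      using that by auto
    show ?thesis
      unfolding \<A>_def
      by (rule separated_weights_not_similar[OF e pos pos shifted_square_weights_separated[OF st]])
  qed
  have "inj_on \<A> {0<..<1}"
    using not_similar similar_algebras_refl by (metis inj_onI)
  then have "\<A> ` {0<..<1} \<approx> (UNIV :: real set)"
    by (simp add: open_interval_eqpoll_reals)
  moreover have "\<forall>A\<in>\<A> ` {0<..<1}. lomonosov_algebra A \<and> complex_type A"
    using closed_complex_structure.lomonosov_graph_algebra[OF graphs]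
      closed_complex_structure.complex_type_graph_algebra[OF graphs]
    by (simp add: \<A>_def)
  moreover have "pairwise (\<lambda>A B. \<not> similar_algebras A B) (\<A> ` {0<..<1})"
    by (intro pairwise_imageI not_similar)
  ultimately show ?thesis
    by blast
qed

end
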